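(* Let $A=\begin{pmatrix} a_1 & a_2 \\ a_3 & a_4 \end{pmatrix}$ and $B=\begin{pmatrix} b_1 & b_2 \\ b_3 & b_4 \end{pmatrix}$ be real matrices, and suppose that the bilinear control system $\Sigma:\ \dot{x}=(A+uB)x$ on $\mathbb{R}^2\smallsetminus\{0\}$ satisfies the Lie algebra rank condition. Then the induced angular system $\mathbb{P}\Sigma$ is controllable on the projective space $\mathbb{P}^1$ if and only if there exists $u\in\mathbb{R}$ such that $$\Delta(u)=P^2+Q^2-R^2<0,$$ where $P=(a_2+a_3)+u(b_2+b_3)$, $Q=(a_4-a_1)+u(b_4-b_1)$ and $R=(a_3-a_2)+u(b_3-b_2)$.
   Context: Admissible controls are the piecewise constant functions $u:\mathbb{R}\to\mathbb{R}$ (finitely many jumps on each bounded interval). Lie algebra rank condition (LARC): let $\mathcal{L}_{\Sigma}\subset gl(2,\mathbb{R})$ be the Lie algebra (bracket $[X,Y]=XY-YX$) generated by $\{A+uB: u\in\mathbb{R}\}$, and $\mathcal{L}_{\Sigma}(x)=\{Cx: C\in\mathcal{L}_{\Sigma}\}$. $\Sigma$ satisfies LARC on $\mathbb{R}^2\smallsetminus\{0\}$ if $\dim\mathcal{L}_{\Sigma}(x)=2$ for all $x\in\mathbb{R}^2\smallsetminus\{0\}$. Induced angular system: $\mathbb{P}^1$ is the space of lines through $0$ in $\mathbb{R}^2$, i.e. the unit circle with $s$ and $-s$ identified. $\mathbb{P}\Sigma$ is the projection of $\Sigma$ to $\mathbb{P}^1$, given by $$\dot{s}(t)=h(A,s(t))+u(t)\,h(B,s(t)),\qquad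 h(C,s)=(C-(s^\top C s)I_2)s,$$ where $s$ is a unit vector representing a point of $\mathbb{P}^1$. Equivalently, its trajectories are the lines spanned by the trajectories of $\Sigma$. Controllable on $\mathbb{P}^1$ means: for any two points $p,q\in\mathbb{P}^1$ there exist an admissible control $u$ and a time $T\ge 0$ such that the trajectory of $\mathbb{P}\Sigma$ with control $u$ starting at $p$ at time $0$ is at $q$ at time $T$. *)

theory Defs
  imports "HOL-Analysis.Analysis"
begin

text \<open>The values at the jump points themselves are unconstrained.\<close>

definition piecewise_constant :: "(real \<Rightarrow> real) \<Rightarrow> bool" where
  "piecewise_constant u \<longleftrightarrow>
     (\<exists>J. (\<forall>a b. finite (J \<inter> {a..b})) \<and>
          (\<forall>a b. {a<..<b} \<inter> J = {} \<longrightarrow> u constant_on {a<..<b}))"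

definition lie_bracket :: "real^2^2 \<Rightarrow> real^2^2 \<Rightarrow> real^2^2" where
  "lie_bracket X Y = X ** Y - Y ** X"

definition lie_subalgebra :: "(real^2^2) set \<Rightarrow> bool" where
  "lie_subalgebra L \<longleftrightarrow> subspace L \<and> (\<forall>X\<in>L. \<forall>Y\<in>L. lie_bracket X Y \<in> L)"

definition system_lie_algebra :: "real^2^2 \<Rightarrow> real^2^2 \<Rightarrow> (real^2^2) set" where
  "system_lie_algebra A B = lie_subalgebra hull (range (\<lambda>u. A + u *\<^sub>R B))"

definition larc :: "real^2^2 \<Rightarrow> real^2^2 \<Rightarrow> bool" where
  "larc A B \<longleftrightarrow>
     (\<forall>x::real^2. x \<noteq> 0 \<longrightarrow> dim ((\<lambda>C. C *v x) ` system_lie_algebra A B) = 2)"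

definition projective_line :: "(real^2) set set" where
  "projective_line = {L. subspace L \<and> dim L = 1}"

definition angular_field :: "real^2^2 \<Rightarrow> real^2 \<Rightarrow> real^2" where
  "angular_field C s = (C - (s \<bullet> (C *v s)) *\<^sub>R mat 1) *v s"

text \<open>
  A trajectory on \<open>[0, T]\<close> is a curve of lines, described through a continuous choice \<open>s\<close> of unit
  vectors spanning them. The choice between \<open>s\<close> and \<open>- s\<close> is immaterial because
  \<open>angular_field C\<close> is odd. The differential equation is required at the times where the control
  is continuous; for a piecewise constant control this leaves out only finitely many times of
  \<open>[0, T]\<close>, so the trajectory is determined by the control and the initial line.
\<close>

definition angular_trajectory ::
  "real^2^2 \<Rightarrow> real^2^2 \<Rightarrow> (real \<Rightarrow> real) \<Rightarrow> real \<Rightarrow> (real \<Rightarrow> (real^2) set) \<Rightarrow> bool" where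
  "angular_trajectory A B u T \<gamma> \<longleftrightarrow>
     (\<exists>s. continuous_on {0..T} s \<and>
          (\<forall>t\<in>{0..T}. norm (s t) = 1 \<and> \<gamma> t = span {s t}) \<and>
          (\<forall>t\<in>{0..T}. isCont u t \<longrightarrow>
             (s has_vector_derivative angular_field A (s t) + u t *\<^sub>R angular_field B (s t))
               (at t within {0..T})))"

definition angular_controllable :: "real^2^2 \<Rightarrow> real^2^2 \<Rightarrow> bool" where
  "angular_controllable A B \<longleftrightarrow>
     (\<forall>p\<in>projective_line. \<forall>q\<in>projective_line.
        \<exists>u T \<gamma>. piecewise_constant u \<and> 0 \<le> T \<and> angular_trajectory A B u T \<gamma> \<and>
                \<gamma> 0 = p \<and> \<gamma> T = q)"

end

theory Submission
  imports Defs
begin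

text \<open>
  \<open>\<Delta>(u)\<close> is the discriminant of the characteristic polynomial of \<open>A + uB\<close>. If it is negative
  for some \<open>u\<close>, the corresponding constant control rotates every line onto every other one.

  Conversely, write \<open>q\<^sub>C(x) = det (x, C x)\<close>, whose discriminant is that of the characteristic
  polynomial of \<open>C\<close>. Along \<open>x' = (A + uB) x\<close> one finds
  \<open>q\<^sub>B(x)' = (tr A + u tr B) q\<^sub>B(x) + n(x)\<close>, where \<open>n\<close> is, up to sign, the quadratic form of
  \<open>[A, B]\<close> and its discriminant is a positive multiple of the discriminant of the polynomial
  \<open>\<Delta>\<close>. If \<open>\<Delta> \<ge> 0\<close> everywhere, then \<open>n\<close> is semidefinite, so one of the cones
  \<open>q\<^sub>B \<ge> 0\<close>, \<open>q\<^sub>B \<le> 0\<close> cannot be left; this obstructs controllability when \<open>q\<^sub>B\<close> is indefinite.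
  Otherwise \<open>A\<close> and \<open>B\<close> have a common real eigenvector, which spans a fixed line.
\<close>

section \<open>Projecting linear dynamics to lines\<close>

lemma angular_field_add_scaleR:
  "angular_field (A + u *\<^sub>R B) s = angular_field A s + u *\<^sub>R angular_field B s"
  by (simp add: angular_field_def scaleR_matrix_vector_assoc[symmetric] algebra_simps)

lemma angular_field_eq: "angular_field C s = C *v s - (s \<bullet> (C *v s)) *\<^sub>R s"
  by (simp add: angular_field_def matrix_vector_mult_diff_rdistrib
      scaleR_matrix_vector_assoc[symmetric])

lemma projective_line_iff: "p \<in> projective_line \<longleftrightarrow> (\<exists>x. x \<noteq> 0 \<and> p = span {x})"
proof
  assume "p \<in> projective_line"
  then have p: "subspace p" "dim p = 1" by (auto simp: projective_line_def)
  obtain b where b: "b \<subseteq> p" "independent b" "p \<subseteq> span b" "card b = dim p"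
    using basis_exists[of p] by blast
  obtain x where x: "b = {x}" using b(4) p(2) card_1_singletonE by metis
  have "p = span {x}" using b(1,3) p(1) x by (metis span_minimal subset_antisym)
  moreover have "x \<noteq> 0" using b(2) x dependent_zero by auto
  ultimately show "\<exists>x. x \<noteq> 0 \<and> p = span {x}" by blast
next
  assume "\<exists>x. x \<noteq> 0 \<and> p = span {x}"
  then show "p \<in> projective_line"
    by (auto simp: projective_line_def dim_eq_card_independent)
qed

text \<open>Turns explicit solutions of a linear equation into solutions on the unit circle:
  differentiating the factor \<open>1 / norm (y t)\<close> contributes exactly the radial correction
  in \<open>angular_field\<close>.\<close>

lemma has_vector_derivative_normalize:
  fixes y :: "real \<Rightarrow> real^2"
  assumes "(y has_vector_derivative C *v y t) (at t within S)" and "y t \<noteq> 0"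
  shows "((\<lambda>t. y t /\<^sub>R norm (y t)) has_vector_derivative angular_field C (y t /\<^sub>R norm (y t)))
           (at t within S)"
proof -
  let ?n = "norm (y t)"
  have n: "?n > 0" using assms by simp
  have yd: "(y has_derivative (\<lambda>h. h *\<^sub>R (C *v y t))) (at t within S)"
    using assms(1) by (simp add: has_vector_derivative_def)
  have nd: "((\<lambda>t. norm (y t)) has_derivative (\<lambda>h. h *\<^sub>R (y t \<bullet> (C *v y t) / ?n))) (at t within S)"
    by (rule has_derivative_eq_rhs[OF has_derivative_compose[OF yd has_derivative_norm[OF assms(2)]]])
       (auto simp: sgn_div_norm fun_eq_iff divide_inverse inner_commute)
  have "((\<lambda>t. inverse (norm (y t))) has_vector_derivative - (y t \<bullet> (C *v y t)) / ?n ^ 3) (at t within S)"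
    unfolding has_vector_derivative_def
    by (rule has_derivative_eq_rhs[OF Deriv.has_derivative_inverse[OF _ nd]])
       (use n in \<open>auto simp: fun_eq_iff field_simps power3_eq_cube\<close>)
  from has_vector_derivative_scaleR[OF this[folded has_real_derivative_iff_has_vector_derivative] assms(1)]
  have "((\<lambda>t. y t /\<^sub>R norm (y t)) has_vector_derivative
      inverse ?n *\<^sub>R (C *v y t) + (- (y t \<bullet> (C *v y t)) / ?n ^ 3) *\<^sub>R y t) (at t within S)" .
  also have "inverse ?n *\<^sub>R (C *v y t) + (- (y t \<bullet> (C *v y t)) / ?n ^ 3) *\<^sub>R y t
      = angular_field C (y t /\<^sub>R ?n)"
    by (simp add: angular_field_eq matrix_vector_mult_scaleR power3_eq_cube divide_inverse mult.commute
        mult.left_commute)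
  finally show ?thesis .
qed

section \<open>Controllability by a constant elliptic control\<close>

text \<open>The scalar part of \<open>A + uB\<close> moves no line, and N squared being
  \<open>-w^2\<close> times the identity gives exp(tN) = cos(wt) I + (sin(wt) / w) N. The orbit of
  \<open>x\<close> is thus an ellipse around 0 in the plane and meets every line.\<close>

lemma angular_controllable_of_rotation:
  fixes A B N :: "real^2^2" and \<mu> w :: real
  assumes C: "A + u *\<^sub>R B = \<mu> *\<^sub>R mat 1 + N"
    and N2: "\<And>x. N *v (N *v x) = - (w\<^sup>2) *\<^sub>R x" and w: "w > 0"
  shows "angular_controllable A B"
  unfolding angular_controllable_def
proof (intro ballI)
  fix p q assume "p \<in> projective_line" "q \<in> projective_line"
  then obtain x z where x: "x \<noteq> 0" "p = span {x}" and z: "z \<noteq> 0" "q = span {z}"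
    by (auto simp: projective_line_iff)
  define J where "J = N *v x"
  \<comment> \<open>\<open>N\<close> has no real eigenvector; concretely, applying aI - bN to the
    vanishing combination (aI + bN) x leaves (a^2 + b^2 w^2) x = 0.\<close>
  have ind: "a = 0 \<and> b = 0" if "a *\<^sub>R x + b *\<^sub>R J = 0" for a b
  proof -
    have e: "a *\<^sub>R J = (b * w\<^sup>2) *\<^sub>R x"
      using arg_cong[OF that, of "\<lambda>v. N *v v"]
      by (simp add: J_def N2 matrix_vector_right_distrib matrix_vector_mult_scaleR)
    have "(a\<^sup>2 + b\<^sup>2 * w\<^sup>2) *\<^sub>R x = a *\<^sub>R (a *\<^sub>R x + b *\<^sub>R J) - b *\<^sub>R (a *\<^sub>R J - (b * w\<^sup>2) *\<^sub>R x)"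
      by (simp add: algebra_simps power2_eq_square)
    also have "\<dots> = 0" using that e by simp
    finally have "a\<^sup>2 + (b * w)\<^sup>2 = 0" using x by (simp add: power_mult_distrib)
    then show ?thesis using w by (simp add: sum_power2_eq_zero_iff)
  qed
  have J: "J \<notin> span {x}"
  proof
    assume "J \<in> span {x}"
    then obtain c where "J = c *\<^sub>R x" by (auto simp: span_singleton)
    then show False using ind[of c "-1"] by simp
  qed
  have "J \<noteq> x" using J span_base[of x "{x}"] by auto
  then have card: "card {J, x} = 2" by simp
  have "independent {J, x}" using J x by (simp add: independent_insert)
  then have "span {J, x} = UNIV"
    using card card_ge_dim_independent[of "{J, x}" UNIV] by auto
  then obtain b where "z - b *\<^sub>R J \<in> span {x}"
    using span_breakdown_eq[of z J "{x}"] by auto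
  then obtain a where "z - b *\<^sub>R J = a *\<^sub>R x" by (auto simp: span_singleton)
  then have ab: "z = a *\<^sub>R x + b *\<^sub>R J" by (simp add: diff_eq_eq)
  \<comment> \<open>Polar coordinates of the target in the basis \<open>x\<close>,
    \<open>J / w\<close>: a = r cos(phi) and b w = r sin(phi), so the orbit \<open>y\<close> reaches
    z / r at time phi / w.\<close>
  define r where "r = sqrt (a\<^sup>2 + (b * w)\<^sup>2)"
  have "a \<noteq> 0 \<or> b \<noteq> 0" using z ab by auto
  then have r: "r > 0" using w by (auto simp: r_def sum_power2_gt_zero_iff)
  have "(a / r)\<^sup>2 + (b * w / r)\<^sup>2 = 1"
    using r by (simp add: power_divide add_divide_distrib[symmetric]) (simp add: r_def)
  then obtain \<phi> where \<phi>: "0 \<le> \<phi>" "a / r = cos \<phi>" "b * w / r = sin \<phi>"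
    using sincos_total_2pi by metis
  define T where "T = \<phi> / w"
  define y where "y = (\<lambda>t. cos (w * t) *\<^sub>R x + (sin (w * t) / w) *\<^sub>R J)"
  have y0: "y t \<noteq> 0" for t
    using ind[of "cos (w * t)" "sin (w * t) / w"] w sin_zero_abs_cos_one[of "w * t"]
    by (auto simp: y_def)
  have yd: "(y has_vector_derivative N *v y t) (at t within S)" for t S
  proof -
    have "((\<lambda>t. cos (w * t)) has_real_derivative - w * sin (w * t)) (at t within S)"
      "((\<lambda>t. sin (w * t) / w) has_real_derivative cos (w * t)) (at t within S)"
      using w by (auto intro!: derivative_eq_intros)
    then have "(y has_vector_derivative (- w * sin (w * t)) *\<^sub>R x + cos (w * t) *\<^sub>R J) (at t within S)"
      unfolding y_def
      by (rule has_vector_derivative_eq_rhs[OF has_vector_derivative_add[OF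
            has_vector_derivative_scaleR[OF _ has_vector_derivative_const]
            has_vector_derivative_scaleR[OF _ has_vector_derivative_const]]]) simp
    moreover have "N *v y t = (- w * sin (w * t)) *\<^sub>R x + cos (w * t) *\<^sub>R J"
      using w by (simp add: y_def J_def N2 matrix_vector_right_distrib matrix_vector_mult_scaleR
          power2_eq_square)
    ultimately show ?thesis by simp
  qed
  define s where "s = (\<lambda>t. y t /\<^sub>R norm (y t))"
  have s1: "norm (s t) = 1" for t using y0 by (simp add: s_def)
  \<comment> \<open>On unit vectors the projection removes the scalar part of the matrix
    completely.\<close>
  have "angular_field (A + u *\<^sub>R B) (s t) = angular_field N (s t)" for t
    using s1[of t] unfolding C
    by (simp add: angular_field_eq matrix_vector_mult_add_rdistrib
      scaleR_matrix_vector_assoc[symmetric] inner_add_right algebra_simps norm_eq_1)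
  then have sd: "(s has_vector_derivative angular_field A (s t) + u *\<^sub>R angular_field B (s t))
      (at t within S)" for t S
    using has_vector_derivative_normalize[OF yd y0]
    by (simp add: s_def angular_field_add_scaleR[symmetric])
  have cont: "continuous_on {0..T} s"
    by (rule continuous_on_vector_derivative) (rule sd)
  have span_s: "span {s t} = span {y t}" for t
    using span_image_scale[of "{y t}" "\<lambda>_. inverse (norm (y t))"] y0 by (simp add: s_def)
  have "y T = (1 / r) *\<^sub>R z"
    using w r \<phi>(2,3)[symmetric] by (simp add: y_def T_def ab scaleR_add_right)
  then have "span {s T} = q"
    using span_image_scale[of "{z}" "\<lambda>_. 1 / r"] r z by (simp add: span_s)
  moreover have "span {s 0} = p" by (simp add: span_s x y_def)
  moreover have "angular_trajectory A B (\<lambda>_. u) T (\<lambda>t. span {s t})"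
    unfolding angular_trajectory_def using cont s1 sd by blast
  moreover have "piecewise_constant (\<lambda>_. u)"
    unfolding piecewise_constant_def by (auto intro!: exI[of _ "{}"] simp: constant_on_def)
  moreover have "0 \<le> T" using w \<phi> by (simp add: T_def)
  ultimately show "\<exists>u T \<gamma>. piecewise_constant u \<and> 0 \<le> T \<and> angular_trajectory A B u T \<gamma> \<and>
                \<gamma> 0 = p \<and> \<gamma> T = q"
    by blast
qed

section \<open>Cones that trajectories cannot leave\<close>

text \<open>If \<open>W\<close> ends negative, look just after the last time at which it is
  nonnegative and compare with an exponential. Only a right neighbourhood of that time matters, so
  \<open>W\<close> need not be differentiable at the jumps of a control.\<close>

lemma nonneg_of_differential_inequality:
  fixes W :: "real \<Rightarrow> real"
  assumes cont: "continuous_on {0..T} W" and W0: "W 0 \<ge> 0" and T: "0 \<le> T"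
    and loc: "\<And>t0. 0 \<le> t0 \<Longrightarrow> t0 < T \<Longrightarrow> \<exists>e>0. \<exists>K. \<forall>t. t0 < t \<and> t < t0 + e \<and> t < T \<longrightarrow>
       (\<exists>D k. (W has_real_derivative D) (at t) \<and> k \<le> K \<and> D \<ge> k * W t)"
  shows "W T \<ge> 0"
proof (rule ccontr)
  assume neg: "\<not> W T \<ge> 0"
  define S where "S = {0..T} \<inter> W -` {0..}"
  have "closed S" unfolding S_def
    by (rule continuous_closed_preimage[OF cont]) auto
  moreover have bdd: "bdd_above S" unfolding S_def by (auto intro: bdd_aboveI[of _ T])
  moreover have ne: "S \<noteq> {}" using W0 T by (auto simp: S_def)
  ultimately have "Sup S \<in> S" using closed_contains_Sup by blast
  define t0 where "t0 = Sup S"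
  have t0: "0 \<le> t0" "t0 \<le> T" "W t0 \<ge> 0" using \<open>Sup S \<in> S\<close> by (auto simp: S_def t0_def)
  then have "t0 < T" using neg by (cases "t0 = T") auto
  have after: "W t < 0" if "t0 < t" "t \<le> T" for t
    using cSup_upper[OF _ bdd, of t] that t0 by (force simp: S_def t0_def)
  obtain e K where e: "e > 0" and K: "\<And>t. t0 < t \<Longrightarrow> t < t0 + e \<Longrightarrow> t < T \<Longrightarrow>
       \<exists>D k. (W has_real_derivative D) (at t) \<and> k \<le> K \<and> D \<ge> k * W t"
    using loc[OF t0(1) \<open>t0 < T\<close>] by blast
  define t1 where "t1 = min T (t0 + e)"
  have t1: "t0 < t1" "t1 \<le> T" "t1 \<le> t0 + e" using e \<open>t0 < T\<close> by (auto simp: t1_def)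
  define V where "V = (\<lambda>t. W t * exp (- K * t))"
  have "V t0 \<le> V t1"
  proof (rule DERIV_nonneg_imp_increasing_open[of t0 t1 V])
    show "t0 \<le> t1" using t1 by simp
    show "continuous_on {t0..t1} V" unfolding V_def
      using t0 t1 by (auto intro!: continuous_intros continuous_on_subset[OF cont])
    fix t assume t: "t0 < t" "t < t1"
    obtain D k where D: "(W has_real_derivative D) (at t)" "k \<le> K" "D \<ge> k * W t"
      using K[of t] t t1 by auto
    have "(V has_real_derivative (D - K * W t) * exp (- K * t)) (at t)"
      unfolding V_def by (auto intro!: derivative_eq_intros D(1) simp: algebra_simps)
    \<comment> \<open>Since \<open>W t\<close> is negative here, the upper bound \<open>K\<close> on
      \<open>k\<close> gives \<open>k * W t\<close> \<ge> \<open>K * W t\<close>; hence the weighted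
      function \<open>V\<close> cannot decrease.\<close>
    moreover have "0 \<le> (D - K * W t) * exp (- K * t)"
      using mult_right_mono_neg[OF D(2) less_imp_le[OF after[of t]]] t t1 D(3)
      by (intro mult_nonneg_nonneg) auto
    ultimately show "\<exists>y. (V has_real_derivative y) (at t) \<and> 0 \<le> y" by blast
  qed
  moreover have "V t0 \<ge> 0" using t0 by (simp add: V_def)
  moreover have "V t1 < 0" using after[of t1] t1 by (simp add: V_def mult_neg_pos)
  ultimately show False by simp
qed

lemma piecewise_constant_right:
  assumes "piecewise_constant u"
  shows "\<exists>e>0. \<exists>c. \<forall>t. t0 < t \<and> t < t0 + e \<longrightarrow> u t = c \<and> isCont u t"
proof -
  obtain J where J: "\<And>a b. finite (J \<inter> {a..b})"
    and u: "\<And>a b. {a<..<b} \<inter> J = {} \<Longrightarrow> u constant_on {a<..<b}"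
    using assms by (auto simp: piecewise_constant_def)
  \<comment> \<open>The point \<open>t0\<close> is removed because it may itself be a jump; the
    remaining jumps in the unit interval are finitely many, hence at positive distance.\<close>
  let ?F = "J \<inter> {t0..t0+1} - {t0}"
  obtain e where e: "e > 0" "\<forall>x\<in>?F. x \<noteq> t0 \<longrightarrow> e \<le> dist t0 x"
    using finite_set_avoid[of ?F t0] J by auto
  define d where "d = min e 1"
  have d: "d > 0" using e by (simp add: d_def)
  have "{t0<..<t0+d} \<inter> J = {}"
    using e(2) by (force simp: d_def dist_real_def)
  then obtain c where c: "\<And>t. t \<in> {t0<..<t0+d} \<Longrightarrow> u t = c"
    using u unfolding constant_on_def by blast
  have "isCont u t" if t: "t \<in> {t0<..<t0+d}" for t
  proof -
    have "\<forall>\<^sub>F x in nhds t. u x = c"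
      using eventually_nhds_in_open[OF open_greaterThanLessThan t] c
      by (auto elim: eventually_mono)
    then have "isCont u t \<longleftrightarrow> isCont (\<lambda>_. c) t" by (rule isCont_cong)
    then show ?thesis by simp
  qed
  then show ?thesis using d c by (intro exI[of _ d] conjI exI[of _ c]) auto
qed

text \<open>\<open>W\<close> is homogeneous of degree 2, so its sign is a property of the line.
  Passing to unit vectors changes its derivative only by a multiple of \<open>W\<close>, so the
  differential inequality survives and the lines with \<open>W\<close> \<ge> 0 form a trap that
  misses the line of \<open>q\<close>.\<close>

lemma not_angular_controllable_of_cone:
  fixes A B M :: "real^2^2" and kA kB :: real
  defines "W \<equiv> \<lambda>x. x \<bullet> (M *v x)"
  assumes mono: "\<And>u x. ((A + u *\<^sub>R B) *v x) \<bullet> (M *v x) + x \<bullet> (M *v ((A + u *\<^sub>R B) *v x))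
                     \<ge> (kA + u * kB) * W x"
    and p: "p \<noteq> 0" "W p \<ge> 0" and q: "W q < 0"
  shows "\<not> angular_controllable A B"
proof
  assume ctrl: "angular_controllable A B"
  have W_scale: "W (c *\<^sub>R x) = c\<^sup>2 * W x" for c x
    by (simp add: W_def matrix_vector_mult_scaleR power2_eq_square)
  have "q \<noteq> 0" using q by (auto simp: W_def)
  then have "span {p} \<in> projective_line" "span {q} \<in> projective_line"
    using p(1) by (auto simp: projective_line_iff)
  then obtain u T \<gamma> where u: "piecewise_constant u" and T: "0 \<le> T"
    and traj: "angular_trajectory A B u T \<gamma>" and ends: "\<gamma> 0 = span {p}" "\<gamma> T = span {q}"
    using ctrl unfolding angular_controllable_def by meson
  obtain s where s: "continuous_on {0..T} s" "\<And>t. t \<in> {0..T} \<Longrightarrow> norm (s t) = 1"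
      "\<And>t. t \<in> {0..T} \<Longrightarrow> \<gamma> t = span {s t}"
    and sd: "\<And>t. t \<in> {0..T} \<Longrightarrow> isCont u t \<Longrightarrow>
       (s has_vector_derivative angular_field A (s t) + u t *\<^sub>R angular_field B (s t)) (at t within {0..T})"
    using traj unfolding angular_trajectory_def by blast
  have "s 0 \<in> span {p}" using s(3)[of 0] ends T span_base[of "s 0" "{s 0}"] by auto
  then have W0: "W (s 0) \<ge> 0" using p by (auto simp: span_singleton W_scale)
  have "s T \<in> span {q}" using s(3)[of T] ends T span_base[of "s T" "{s T}"] by auto
  then obtain c where c: "s T = c *\<^sub>R q" by (auto simp: span_singleton)
  have "c \<noteq> 0" using c s(2)[of T] T by auto
  then have WT: "W (s T) < 0" using c q by (simp add: W_scale mult_pos_neg)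
  have "W (s T) \<ge> 0"
  proof (rule nonneg_of_differential_inequality[of T "\<lambda>t. W (s t)"])
    show "continuous_on {0..T} (\<lambda>t. W (s t))" unfolding W_def
      by (intro continuous_intros s(1)
          bounded_linear.continuous_on[OF matrix_vector_mul_bounded_linear])
    show "0 \<le> W (s 0)" "0 \<le> T" by fact+
    fix t0 assume t0: "0 \<le> t0" "t0 < T"
    obtain e c where e: "e > 0" and c: "\<And>t. t0 < t \<Longrightarrow> t < t0 + e \<Longrightarrow> u t = c \<and> isCont u t"
      using piecewise_constant_right[OF u, of t0] by blast
    define C where "C = A + c *\<^sub>R B"
    \<comment> \<open>The rate along the curve is kA + c kB - 2 (s . C s), which varies with s; the
      operator norm bounds it uniformly for unit vectors.\<close>
    define K where "K = kA + c * kB + 2 * onorm ((*v) C)"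
    have "\<exists>D k. ((\<lambda>t. W (s t)) has_real_derivative D) (at t) \<and> k \<le> K \<and> D \<ge> k * W (s t)"
      if t: "t0 < t" "t < t0 + e" "t < T" for t
    proof (intro exI conjI)
      have at: "at t within {0..T} = at t"
        using t t0 by (intro at_within_interior) auto
      let ?f = "angular_field C (s t)" and ?x = "s t"
      have "(s has_vector_derivative ?f) (at t)"
        using sd[of t] c[OF t(1,2)] t t0 by (simp add: at C_def angular_field_add_scaleR)
      then have der: "(s has_derivative (\<lambda>h. h *\<^sub>R ?f)) (at t)"
        by (simp add: has_vector_derivative_def)
      have derM: "((\<lambda>t. M *v s t) has_derivative (\<lambda>h. M *v (h *\<^sub>R ?f))) (at t)"
        by (rule bounded_linear.has_derivative[OF matrix_vector_mul_bounded_linear der])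
      show "((\<lambda>t. W (s t)) has_real_derivative (?f \<bullet> (M *v ?x) + ?x \<bullet> (M *v ?f))) (at t)"
        unfolding W_def has_field_derivative_def
        by (rule has_derivative_eq_rhs[OF has_derivative_inner[OF der derM]])
           (auto simp: fun_eq_iff matrix_vector_mult_scaleR algebra_simps)
      let ?k = "kA + c * kB - 2 * (?x \<bullet> (C *v ?x))"
      have "norm ?x = 1" using s(2)[of t] t t0 by auto
      moreover have "norm (C *v ?x) \<le> onorm ((*v) C) * norm ?x"
        by (rule onorm[OF matrix_vector_mul_bounded_linear])
      ultimately have "\<bar>?x \<bullet> (C *v ?x)\<bar> \<le> onorm ((*v) C)"
        using Cauchy_Schwarz_ineq2[of ?x "C *v ?x"] by simp
      then show "?k \<le> K" by (auto simp: K_def)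
      have "?f \<bullet> (M *v ?x) + ?x \<bullet> (M *v ?f) =
        (C *v ?x) \<bullet> (M *v ?x) + ?x \<bullet> (M *v (C *v ?x)) - 2 * (?x \<bullet> (C *v ?x)) * W ?x"
        by (simp add: angular_field_eq W_def matrix_vector_mult_diff_distrib
            matrix_vector_mult_scaleR inner_diff_left inner_diff_right)
      then show "?k * W ?x \<le> ?f \<bullet> (M *v ?x) + ?x \<bullet> (M *v ?f)"
        using mono[where u = c and x = ?x] by (simp add: C_def algebra_simps)
    qed
    then show "\<exists>e>0. \<exists>K. \<forall>t. t0 < t \<and> t < t0 + e \<and> t < T \<longrightarrow>
       (\<exists>D k. ((\<lambda>t. W (s t)) has_real_derivative D) (at t) \<and> k \<le> K \<and> D \<ge> k * W (s t))"
      using e by blast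
  qed
  then show False using WT by simp
qed

section \<open>Two-by-two matrices and binary quadratic forms\<close>

lemma matrix2_vector_mult:
  fixes x :: "real^2"
  shows "(vector [vector [a, b], vector [c, d]] :: real^2^2) *v x
    = vector [a * x $ 1 + b * x $ 2, c * x $ 1 + d * x $ 2]"
  by (simp add: vec_eq_iff forall_2 matrix_vector_mult_def sum_2)

lemma matrix2_add_scaleR:
  "(vector [vector [a1, a2], vector [a3, a4]] :: real^2^2) + u *\<^sub>R vector [vector [b1, b2], vector [b3, b4]]
    = vector [vector [a1 + u * b1, a2 + u * b2], vector [a3 + u * b3, a4 + u * b4]]"
  by (simp add: vec_eq_iff forall_2)

lemma inner_real2: "(x :: real^2) \<bullet> y = x $ 1 * y $ 1 + x $ 2 * y $ 2"
  by (simp add: inner_vec_def sum_2)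

lemma quadratic_nonneg_discriminant:
  fixes \<alpha> \<beta> \<gamma> :: real
  assumes nn: "\<And>u. \<alpha> * u\<^sup>2 + 2 * \<beta> * u + \<gamma> \<ge> 0"
  shows "\<alpha> \<ge> 0" and "\<beta>\<^sup>2 \<le> \<alpha> * \<gamma>"
proof -
  show "\<alpha> \<ge> 0"
  proof (rule ccontr)
    assume neg: "\<not> \<alpha> \<ge> 0"
    \<comment> \<open>Adding the values at \<open>k\<close> and \<open>-k\<close> cancels the linear
      term; this \<open>k\<close> is large enough that the quadratic term outweighs the constant
      one.\<close>
    define k where "k = 1 + \<bar>\<gamma>\<bar> / (- \<alpha>)"
    have "k \<ge> 1" using neg by (simp add: k_def divide_nonneg_neg)
    then have "k \<le> k\<^sup>2" by (simp add: power2_eq_square)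
    then have "\<alpha> * k\<^sup>2 \<le> \<alpha> * k" using neg by (intro mult_left_mono_neg) auto
    also have "\<alpha> * k = \<alpha> - \<bar>\<gamma>\<bar>" using neg by (simp add: k_def field_simps)
    finally show False using nn[of k] nn[of "- k"] neg by simp
  qed
  show "\<beta>\<^sup>2 \<le> \<alpha> * \<gamma>"
  proof (cases "\<alpha> = 0")
    case True
    have "\<beta> = 0"
    proof (rule ccontr)
      assume "\<beta> \<noteq> 0"
      \<comment> \<open>At this point the affine function takes the value -1.\<close>
      then show False using nn[of "- (\<gamma> + 1) / (2 * \<beta>)"] True by simp
    qed
    then show ?thesis using True by simp
  next
    case False
    then have a: "\<alpha> > 0" using \<open>\<alpha> \<ge> 0\<close> by simp
    \<comment> \<open>Evaluation at the vertex of the parabola.\<close>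
    have "0 \<le> \<alpha> * (\<alpha> * (- \<beta> / \<alpha>)\<^sup>2 + 2 * \<beta> * (- \<beta> / \<alpha>) + \<gamma>)"
      using nn[of "- \<beta> / \<alpha>"] a by (intro mult_nonneg_nonneg) auto
    also have "\<dots> = \<alpha> * \<gamma> - \<beta>\<^sup>2"
      using a by (simp add: field_simps power2_eq_square)
    finally show ?thesis by simp
  qed
qed

lemma semidefinite_binary_form:
  fixes n1 n2 n3 :: real
  assumes disc: "n2\<^sup>2 \<le> 4 * n1 * n3"
  shows "(\<forall>x y. n1 * x\<^sup>2 + n2 * x * y + n3 * y\<^sup>2 \<ge> 0) \<or> (\<forall>x y. n1 * x\<^sup>2 + n2 * x * y + n3 * y\<^sup>2 \<le> 0)"
proof (cases "n1 = 0")
  case True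
  then have "n2 = 0" using disc by simp
  then show ?thesis using True by (cases "n3 \<ge> 0") (auto simp: mult_nonpos_nonneg)
next
  case False
  have sq: "4 * n1 * (n1 * x\<^sup>2 + n2 * x * y + n3 * y\<^sup>2) \<ge> 0" for x y
  proof -
    have "4 * n1 * (n1 * x\<^sup>2 + n2 * x * y + n3 * y\<^sup>2)
        = (2 * n1 * x + n2 * y)\<^sup>2 + (4 * n1 * n3 - n2\<^sup>2) * y\<^sup>2"
      by (simp add: power2_eq_square algebra_simps)
    also have "\<dots> \<ge> 0" using disc by (intro add_nonneg_nonneg mult_nonneg_nonneg) auto
    finally show ?thesis .
  qed
  consider "n1 > 0" | "n1 < 0" using False by linarith
  then show ?thesis
  proof cases
    case 1
    then have "n1 * x\<^sup>2 + n2 * x * y + n3 * y\<^sup>2 \<ge> 0" for x y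
      using sq[of x y] by (simp add: zero_le_mult_iff)
    then show ?thesis by blast
  next
    case 2
    then have "n1 * x\<^sup>2 + n2 * x * y + n3 * y\<^sup>2 \<le> 0" for x y
      using sq[of x y] by (simp add: zero_le_mult_iff)
    then show ?thesis by blast
  qed
qed

text \<open>If the form omitted a sign, setting w = 1 would leave a quadratic in v of constant sign,
  whose discriminant could not be positive.\<close>

lemma indefinite_binary_form:
  fixes p e r :: real
  assumes disc: "e\<^sup>2 + 4 * p * r > 0"
  shows "\<exists>v w. p * v\<^sup>2 + e * v * w - r * w\<^sup>2 > 0" and "\<exists>v w. p * v\<^sup>2 + e * v * w - r * w\<^sup>2 < 0"
proof -
  show "\<exists>v w. p * v\<^sup>2 + e * v * w - r * w\<^sup>2 < 0"
  proof (rule ccontr)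
    assume "\<nexists>v w. p * v\<^sup>2 + e * v * w - r * w\<^sup>2 < 0"
    then have "p * v\<^sup>2 + e * v * 1 - r * 1\<^sup>2 \<ge> 0" for v by (metis not_less)
    then have "(e / 2)\<^sup>2 \<le> p * (- r)"
      by (intro quadratic_nonneg_discriminant(2)) simp
    then show False using disc by (simp add: power_divide)
  qed
  show "\<exists>v w. p * v\<^sup>2 + e * v * w - r * w\<^sup>2 > 0"
  proof (rule ccontr)
    assume "\<nexists>v w. p * v\<^sup>2 + e * v * w - r * w\<^sup>2 > 0"
    then have "p * v\<^sup>2 + e * v * 1 - r * 1\<^sup>2 \<le> 0" for v by (metis not_less)
    then have "(- e / 2)\<^sup>2 \<le> (- p) * r"
      by (intro quadratic_nonneg_discriminant(2)) (simp add: algebra_simps)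
    then show False using disc by (simp add: power_divide)
  qed
qed

lemma isotropic_vector:
  fixes p e r :: real
  assumes "e\<^sup>2 + 4 * p * r \<ge> 0"
  shows "\<exists>v w. (v \<noteq> 0 \<or> w \<noteq> 0) \<and> p * v\<^sup>2 + e * v * w - r * w\<^sup>2 = 0"
proof (cases "p = 0")
  case True
  then show ?thesis by (intro exI[of _ 1] exI[of _ 0]) simp
next
  case False
  define D where "D = sqrt (e\<^sup>2 + 4 * p * r)"
  have D: "D * D = e * e + 4 * p * r"
    using assms by (simp add: D_def power2_eq_square flip: real_sqrt_mult)
  \<comment> \<open>The quadratic formula in homogeneous form, v : w = (D - e) : 2p.\<close>
  have "p * (D - e)\<^sup>2 + e * (D - e) * (2 * p) - r * (2 * p)\<^sup>2 = p * (D * D - e * e - 4 * p * r)"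
    by (simp add: power2_eq_square algebra_simps)
  then show ?thesis using False D by (intro exI[of _ "D - e"] exI[of _ "2 * p"]) simp
qed

text \<open>A nonzero form with zero discriminant is a multiple of the square of a linear form. The
  mixed condition \<open>ab\<close> says that the other form vanishes on the double root, which is
  (-e, 2 b3) or (2 b2, e). If the degenerate form is zero, any isotropic vector of the other one
  serves.\<close>

lemma common_isotropic_vector:
  fixes a2 a3 d b2 b3 e :: real
  assumes a: "d\<^sup>2 + 4 * a3 * a2 \<ge> 0" and b: "e\<^sup>2 + 4 * b3 * b2 = 0"
    and ab: "d * e + 2 * (a2 * b3 + a3 * b2) = 0"
  shows "\<exists>v w. (v \<noteq> 0 \<or> w \<noteq> 0) \<and> a3 * v\<^sup>2 + d * v * w - a2 * w\<^sup>2 = 0 \<and>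
    b3 * v\<^sup>2 + e * v * w - b2 * w\<^sup>2 = 0"
proof -
  have e: "e * e = - 4 * b3 * b2" using b by (simp add: power2_eq_square)
  consider "b3 \<noteq> 0" | "b2 \<noteq> 0" | "b3 = 0" "b2 = 0" "e = 0" using b by fastforce
  then show ?thesis
  proof cases
    case 1
    have "a3 * (- e)\<^sup>2 + d * (- e) * (2 * b3) - a2 * (2 * b3)\<^sup>2
        = a3 * (e * e + 4 * b3 * b2) - 2 * b3 * (d * e + 2 * (a2 * b3 + a3 * b2))"
      "b3 * (- e)\<^sup>2 + e * (- e) * (2 * b3) - b2 * (2 * b3)\<^sup>2 = - b3 * (e * e + 4 * b3 * b2)"
      by (simp_all add: power2_eq_square algebra_simps)
    then show ?thesis using 1 e ab by (intro exI[of _ "- e"] exI[of _ "2 * b3"]) simp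
  next
    case 2
    have "a3 * (2 * b2)\<^sup>2 + d * (2 * b2) * e - a2 * e\<^sup>2
        = 2 * b2 * (d * e + 2 * (a2 * b3 + a3 * b2)) - a2 * (e * e + 4 * b3 * b2)"
      "b3 * (2 * b2)\<^sup>2 + e * (2 * b2) * e - b2 * e\<^sup>2 = b2 * (e * e + 4 * b3 * b2)"
      by (simp_all add: power2_eq_square algebra_simps)
    then show ?thesis using 2 e ab by (intro exI[of _ "2 * b2"] exI[of _ e]) simp
  next
    case 3
    then show ?thesis using isotropic_vector[OF a] by auto
  qed
qed

text \<open>The hypothesis says det(z, Cz) = 0 for z = (v, w), so z is an eigenvector of C. The
  functional wx - vy has kernel spanned by z, hence is an eigenvector of the transpose.\<close>

lemma invariant_functional:
  fixes a1 a2 a3 a4 v w :: real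
  assumes vw: "v \<noteq> 0 \<or> w \<noteq> 0" and iso: "a3 * v\<^sup>2 + (a4 - a1) * v * w - a2 * w\<^sup>2 = 0"
  shows "\<exists>\<mu>. \<forall>x y. w * (a1 * x + a2 * y) - v * (a3 * x + a4 * y) = \<mu> * (w * x - v * y)"
proof (cases "w = 0")
  case True
  then have "v \<noteq> 0" "a3 = 0" using vw iso by auto
  then show ?thesis using True by (intro exI[of _ a4]) (simp add: algebra_simps)
next
  case False
  have "w * (w * (a1 * x + a2 * y) - v * (a3 * x + a4 * y)) = (a1 * w - v * a3) * (w * x - v * y)" for x y
  proof -
    have "w * (w * (a1 * x + a2 * y) - v * (a3 * x + a4 * y)) - (a1 * w - v * a3) * (w * x - v * y)
       = - y * (a3 * v\<^sup>2 + (a4 - a1) * v * w - a2 * w\<^sup>2)"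
      by (simp add: power2_eq_square algebra_simps)
    then show ?thesis unfolding iso by simp
  qed
  then have "w * (a1 * x + a2 * y) - v * (a3 * x + a4 * y) = ((a1 * w - v * a3) / w) * (w * x - v * y)" for x y
    using False by (subst mult_left_cancel[OF False, symmetric]) simp
  then show ?thesis by blast
qed

section \<open>The discriminant criterion\<close>

theorem theorem3p1:
  fixes a1 a2 a3 a4 b1 b2 b3 b4 :: real and A B :: "real^2^2"
  assumes "A = vector [vector [a1, a2], vector [a3, a4]]"
    and "B = vector [vector [b1, b2], vector [b3, b4]]"
    and "larc A B"
  shows "angular_controllable A B \<longleftrightarrow>
    (\<exists>u::real.
       let P = (a2 + a3) + u * (b2 + b3);
           Q = (a4 - a1) + u * (b4 - b1);
           R = (a3 - a2) + u * (b3 - b2)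
       in P\<^sup>2 + Q\<^sup>2 - R\<^sup>2 < 0)"
proof -
  note A = assms(1) and B = assms(2)
  define d e where "d = a4 - a1" and "e = b4 - b1"
  \<comment> \<open>This is P^2 + Q^2 - R^2 with P^2 - R^2 factored as (P - R)(P + R).\<close>
  define \<Delta> where "\<Delta> = (\<lambda>u. (d + u * e)\<^sup>2 + 4 * (a2 + u * b2) * (a3 + u * b3))"
  have "angular_controllable A B" if neg: "\<Delta> u < 0" for u
  proof (rule angular_controllable_of_rotation)
    define c1 c2 c3 c4 where c: "c1 = a1 + u * b1" "c2 = a2 + u * b2" "c3 = a3 + u * b3"
      "c4 = a4 + u * b4"
    \<comment> \<open>The traceless part of A + uB; by Cayley-Hamilton its square is the scalar
      \<Delta>(u) / 4, which dictates the angular speed below.\<close>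
    define N :: "real^2^2" where "N = vector [vector [(c1 - c4) / 2, c2], vector [c3, (c4 - c1) / 2]]"
    show "A + u *\<^sub>R B = ((c1 + c4) / 2) *\<^sub>R mat 1 + N"
      unfolding A B matrix2_add_scaleR N_def c[symmetric]
      by (simp add: vec_eq_iff forall_2 mat_def field_simps)
    show "sqrt (- \<Delta> u / 4) > 0" using neg by simp
    have "(sqrt (- \<Delta> u / 4))\<^sup>2 = - \<Delta> u / 4" using neg by simp
    also have "\<dots> = - (((c4 - c1) / 2)\<^sup>2 + c2 * c3)"
      by (simp add: \<Delta>_def c d_def e_def power2_eq_square field_simps)
    finally have sq: "(sqrt (- \<Delta> u / 4))\<^sup>2 = - (((c4 - c1) / 2)\<^sup>2 + c2 * c3)" .
    show "N *v (N *v x) = - ((sqrt (- \<Delta> u / 4))\<^sup>2) *\<^sub>R x" for x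
      unfolding sq
      by (simp add: N_def matrix2_vector_mult vec_eq_iff forall_2 power2_eq_square field_simps)
  qed
  moreover have "\<not> angular_controllable A B" if nn: "\<And>u. \<Delta> u \<ge> 0"
  proof -
    \<comment> \<open>\<alpha> and \<gamma> are the discriminants of the forms det(x, Bx) and det(x,
      Ax), and \<beta> is their polarization.\<close>
    define \<alpha> \<beta> \<gamma> where "\<alpha> = e\<^sup>2 + 4 * b3 * b2" and "\<beta> = d * e + 2 * (a2 * b3 + a3 * b2)"
      and "\<gamma> = d\<^sup>2 + 4 * a3 * a2"
    have \<Delta>: "\<Delta> u = \<alpha> * u\<^sup>2 + 2 * \<beta> * u + \<gamma>" for u
      by (simp add: \<Delta>_def \<alpha>_def \<beta>_def \<gamma>_def power2_eq_square algebra_simps)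
    have \<alpha>: "\<alpha> \<ge> 0" and \<beta>: "\<beta>\<^sup>2 \<le> \<alpha> * \<gamma>"
      using quadratic_nonneg_discriminant[of \<alpha> \<beta> \<gamma>] nn by (auto simp: \<Delta>)
    have \<gamma>: "\<gamma> \<ge> 0" using nn[of 0] by (simp add: \<Delta>)
    show ?thesis
    proof (cases "\<alpha> = 0")
      case True
      then have "\<beta> = 0" using \<beta> by simp
      then obtain v w where vw: "v \<noteq> 0 \<or> w \<noteq> 0"
        and "a3 * v\<^sup>2 + d * v * w - a2 * w\<^sup>2 = 0" "b3 * v\<^sup>2 + e * v * w - b2 * w\<^sup>2 = 0"
        using common_isotropic_vector[of d a3 a2 e b3 b2] True \<gamma>
        unfolding \<alpha>_def \<beta>_def \<gamma>_def by blast
      then obtain \<mu> \<nu> where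
        \<mu>: "\<And>x y. w * (a1 * x + a2 * y) - v * (a3 * x + a4 * y) = \<mu> * (w * x - v * y)" and
        \<nu>: "\<And>x y. w * (b1 * x + b2 * y) - v * (b3 * x + b4 * y) = \<nu> * (w * x - v * y)"
        using invariant_functional[OF vw] unfolding d_def e_def by metis
      txt \<open>\<open>M\<close> represents \<open>- \<ell>\<^sup>2\<close>, where \<open>\<ell>\<close> vanishes on the common eigenline.\<close>
      define M :: "real^2^2" where
        "M = vector [vector [- w * w, w * v], vector [w * v, - v * v]]"
      have M: "x \<bullet> (M *v y) = - (w * x$1 - v * x$2) * (w * y$1 - v * y$2)" for x y
        by (simp add: M_def matrix2_vector_mult inner_real2 algebra_simps)
      show ?thesis
      \<comment> \<open>The trapping cone is the common eigenline itself. The rates are doubled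
        because \<open>M\<close> involves the square of the functional.\<close>
      proof (rule not_angular_controllable_of_cone[where M = M and kA = "2 * \<mu>" and kB = "2 * \<nu>"])
        fix u and x :: "real^2"
        let ?y = "(A + u *\<^sub>R B) *v x"
        have "w * ?y$1 - v * ?y$2 = (w * (a1 * x$1 + a2 * x$2) - v * (a3 * x$1 + a4 * x$2)) +
          u * (w * (b1 * x$1 + b2 * x$2) - v * (b3 * x$1 + b4 * x$2))"
          unfolding A B matrix2_add_scaleR matrix2_vector_mult by (simp add: algebra_simps)
        then have eq: "w * ?y$1 - v * ?y$2 = (\<mu> + u * \<nu>) * (w * x$1 - v * x$2)"
          unfolding \<mu> \<nu> by (simp add: algebra_simps)
        show "(2 * \<mu> + u * (2 * \<nu>)) * (x \<bullet> (M *v x)) \<le> ?y \<bullet> (M *v x) + x \<bullet> (M *v ?y)"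
          unfolding M eq by (simp add: algebra_simps)
      next
        show "(vector [v, w] :: real^2) \<noteq> 0" using vw by (auto simp: vec_eq_iff forall_2)
        show "0 \<le> vector [v, w] \<bullet> (M *v vector [v, w])" by (simp add: M)
        have "w * w + v * v > 0" using vw by (simp add: sum_squares_gt_zero_iff disj_commute)
        then show "vector [w, - v] \<bullet> (M *v vector [w, - v]) < 0"
          unfolding M by (simp add: mult_neg_pos)
      qed
    next
      case False
      \<comment> \<open>Coefficients of det(x, [B, A] x).\<close>
      define n1 n2 n3 where n: "n1 = e * a3 - b3 * d" "n2 = 2 * (b3 * a2 - b2 * a3)"
        "n3 = e * a2 - b2 * d"
      have "4 * n1 * n3 - n2\<^sup>2 = \<alpha> * \<gamma> - \<beta>\<^sup>2"
        by (simp add: n \<alpha>_def \<beta>_def \<gamma>_def power2_eq_square algebra_simps)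
      then have "n2\<^sup>2 \<le> 4 * n1 * n3" using \<beta> by simp
      \<comment> \<open>The sign \<sigma> selects which of the two cones of the form of B is the
        trap.\<close>
      then obtain \<sigma> :: real where \<sigma>: "\<sigma> = 1 \<or> \<sigma> = - 1"
        and semi: "\<And>x y. \<sigma> * (n1 * x\<^sup>2 + n2 * x * y + n3 * y\<^sup>2) \<ge> 0"
        using semidefinite_binary_form[of n2 n1 n3] that[of 1] that[of "- 1"]
        unfolding mult_1 mult_minus1 neg_0_le_iff_le by blast
      define q where "q = (\<lambda>x y. b3 * x\<^sup>2 + e * x * y - b2 * y\<^sup>2)"
      define M :: "real^2^2" where
        "M = vector [vector [\<sigma> * b3, \<sigma> * e / 2], vector [\<sigma> * e / 2, - \<sigma> * b2]]"
      have M: "x \<bullet> (M *v x) = \<sigma> * q (x$1) (x$2)" for x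
        by (simp add: M_def q_def matrix2_vector_mult inner_real2 power2_eq_square algebra_simps)
      have "\<alpha> > 0" using \<alpha> False by simp
      then have ind: "\<exists>v w. q v w > 0" "\<exists>v w. q v w < 0"
        unfolding q_def \<alpha>_def by (rule indefinite_binary_form)+
      obtain v w where pos: "\<sigma> * q v w > 0"
        using ind \<sigma> by auto
      obtain v' w' where neg: "\<sigma> * q v' w' < 0"
        using ind \<sigma> by auto
      show ?thesis
      proof (rule not_angular_controllable_of_cone[where M = M and kA = "a1 + a4" and kB = "b1 + b4"])
        fix u and x :: "real^2"
        let ?y = "(A + u *\<^sub>R B) *v x"
        \<comment> \<open>For C = A + uB, det(Cx, Bx) + det(x, BCx) = tr(C) det(x, Bx) + det(x,
          [B, C] x), and [B, C] = [B, A], so the remainder is independent of u.\<close>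
        have "?y \<bullet> (M *v x) + x \<bullet> (M *v ?y) = (a1 + a4 + u * (b1 + b4)) * (x \<bullet> (M *v x)) +
            \<sigma> * (n1 * (x$1)\<^sup>2 + n2 * x$1 * x$2 + n3 * (x$2)\<^sup>2)"
          unfolding A B matrix2_add_scaleR M
          by (simp add: M_def matrix2_vector_mult inner_real2 q_def n d_def e_def power2_eq_square field_simps)
        then show "(a1 + a4 + u * (b1 + b4)) * (x \<bullet> (M *v x)) \<le> ?y \<bullet> (M *v x) + x \<bullet> (M *v ?y)"
          using semi by simp
      next
        show "(vector [v, w] :: real^2) \<noteq> 0" using pos by (auto simp: vec_eq_iff forall_2 q_def)
        show "0 \<le> vector [v, w] \<bullet> (M *v vector [v, w])" using pos by (simp add: M)
        show "vector [v', w'] \<bullet> (M *v vector [v', w']) < 0" using neg by (simp add: M)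
      qed
    qed
  qed
  ultimately have "angular_controllable A B \<longleftrightarrow> (\<exists>u. \<Delta> u < 0)" by (metis not_less)
  moreover have "((a2 + a3) + u * (b2 + b3))\<^sup>2 + ((a4 - a1) + u * (b4 - b1))\<^sup>2
      - ((a3 - a2) + u * (b3 - b2))\<^sup>2 = \<Delta> u" for u
    by (simp add: \<Delta>_def d_def e_def power2_eq_square algebra_simps)
  ultimately show ?thesis by (simp only: Let_def)
qed

end
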